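(* Let $T$ be a subsystem of a Lie triple system $S$ over a field $\mathbf{F}$. Then $S$ is a system of quotients of $T$ if and only if $S$ is ideally absorbed into $T$.
   Context: $\mathbf{F}$ is a field of arbitrary characteristic. A Lie triple system (LTS) over $\mathbf{F}$ is a vector space $T$ with a trilinear map $(x,y,z)\mapsto[x,y,z]$ such that $[x,x,z]=0$, $[x,y,z]+[y,z,x]+[z,x,y]=0$, and $[u,v,[x,y,z]]=[[u,v,x],y,z]+[x,[u,v,y],z]+[x,y,[u,v,z]]$ for all $x,y,z,u,v\in T$. A subsystem of $T$ is a subspace $I$ with $[I,I,I]\subseteq I$; an ideal of $T$ is a subspace $I$ with $[I,T,T]\subseteq I$. Brackets of subspaces denote the linear span of the corresponding brackets of elements; an element in such a bracket stands for itself. The centralizer in $T$ of a nonempty subset $I\subseteq T$ is $C_T(I)=\{x\in T\mid [x,I,T]=[T,I,x]=0\}$. Let $T$ be a subsystem of an LTS $S$. Define $R(x,y)(z)=[z,x,y]$ for $x,y,z\in S$. For $s\in S$, let ${}_T(s)$ be the linear span in $S$ of $s$ and all elements $R(x_1,y_1)\cdots R(x_n,y_n)(s)$ with $n\in\mathbb{N}$ and $x_1,\dots,x_n,y_1,\dots,y_n\in T$, and let $$(T:s)=\{x\in T\mid [x,T,{}_T(s)]+[x,{}_T(s),T]\subseteq T\}.$$ $S$ is a system of quotients of $T$ if for all $s,s'\in S$ with $s\neq 0$ there exist $x,y\in T$ such that $[s,x,y]\neq 0$ and ($x\in (T:s')$ or $y\in (T:s')$). $S$ is ideally absorbed into $T$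 if for every $0\neq s\in S$ there exists an ideal $I$ of $T$ with $C_T(I)=0$ such that $0\neq [s,I,T]+[s,T,I]\subseteq T$. *)

theory Defs
  imports Complex_Main "HOL-Library.Set_Algebras"
begin

text \<open>The Lie triple system \<open>S\<close> is the whole type \<open>'v\<close>; its subsystem \<open>T\<close> and the ideals
  of \<open>T\<close> are sets of type \<open>'v set\<close>. Sums of subspaces are the pointwise sums of
  \<open>Set_Algebras\<close>.\<close>

locale lie_triple_system = vector_space scale
  for scale :: "'f::field \<Rightarrow> 'v::ab_group_add \<Rightarrow> 'v" +
  fixes br :: "'v \<Rightarrow> 'v \<Rightarrow> 'v \<Rightarrow> 'v"
  assumes linear_br_1: "Vector_Spaces.linear scale scale (\<lambda>x. br x y z)"
    and linear_br_2: "Vector_Spaces.linear scale scale (\<lambda>y. br x y z)"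
    and linear_br_3: "Vector_Spaces.linear scale scale (\<lambda>z. br x y z)"
    and br_self: "br x x z = 0"
    and br_cyclic: "br x y z + br y z x + br z x y = 0"
    and br_derivation:
      "br u v (br x y z) = br (br u v x) y z + br x (br u v y) z + br x y (br u v z)"
begin

definition Br :: "'v set \<Rightarrow> 'v set \<Rightarrow> 'v set \<Rightarrow> 'v set" where
  "Br A B C = span {br a b c | a b c. a \<in> A \<and> b \<in> B \<and> c \<in> C}"

definition subsystem :: "'v set \<Rightarrow> bool" where
  "subsystem T \<longleftrightarrow> subspace T \<and> Br T T T \<subseteq> T"

definition ideal_of :: "'v set \<Rightarrow> 'v set \<Rightarrow> bool" where
  "ideal_of T I \<longleftrightarrow> subspace I \<and> I \<subseteq> T \<and> Br I T T \<subseteq> I"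

definition centralizer :: "'v set \<Rightarrow> 'v set \<Rightarrow> 'v set" where
  "centralizer T I = {x \<in> T. Br {x} I T = {0} \<and> Br T I {x} = {0}}"

definition R :: "'v \<Rightarrow> 'v \<Rightarrow> 'v \<Rightarrow> 'v" where
  "R x y z = br z x y"

text \<open>The space \<open>\<^sub>T(s)\<close>: for \<open>ps = [(x\<^sub>1, y\<^sub>1), \<dots>, (x\<^sub>n, y\<^sub>n)]\<close> the fold below is
  \<open>R x\<^sub>1 y\<^sub>1 (\<dots> (R x\<^sub>n y\<^sub>n s))\<close>.\<close>
definition orbit_span :: "'v set \<Rightarrow> 'v \<Rightarrow> 'v set" where
  "orbit_span T s =
     span (insert s {foldr (\<lambda>(x, y). R x y) ps s | ps. set ps \<subseteq> T \<times> T})"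

text \<open>The set \<open>(T : s)\<close>.\<close>
definition colon :: "'v set \<Rightarrow> 'v \<Rightarrow> 'v set" where
  "colon T s = {x \<in> T. Br {x} T (orbit_span T s) + Br {x} (orbit_span T s) T \<subseteq> T}"

definition system_of_quotients :: "'v set \<Rightarrow> bool" where
  "system_of_quotients T \<longleftrightarrow>
     (\<forall>s s'. s \<noteq> 0 \<longrightarrow>
        (\<exists>x\<in>T. \<exists>y\<in>T. br s x y \<noteq> 0 \<and> (x \<in> colon T s' \<or> y \<in> colon T s')))"

definition ideally_absorbed :: "'v set \<Rightarrow> bool" where
  "ideally_absorbed T \<longleftrightarrow>
     (\<forall>s. s \<noteq> 0 \<longrightarrow>
        (\<exists>I. ideal_of T I \<and> centralizer T I = {0} \<and>
             Br {s} I T + Br {s} T I \<noteq> {0} \<and> Br {s} I T + Br {s} T I \<subseteq> T))"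

end

end

theory Submission imports Defs begin

text \<open>
  If \<open>S\<close> is a system of quotients, then \<open>(T : s)\<close> itself is an ideal of \<open>T\<close> absorbing \<open>s\<close>, and
  its centralizer vanishes by the quotient condition. Conversely, for an ideal \<open>I\<close> of \<open>T\<close> and a
  \<open>T\<close>-invariant subspace \<open>U\<close>, the elements that all brackets with \<open>I\<close> and \<open>T\<close> send into \<open>U\<close> are
  stable under every \<open>R x y\<close> with \<open>x, y \<in> T\<close>. For \<open>U = T\<close> this shows that an ideal absorbing \<open>s'\<close>
  lies in \<open>(T : s')\<close>. For \<open>U = 0\<close> it shows that if some \<open>s \<noteq> 0\<close> were annihilated by an ideal \<open>I\<close>
  with zero centralizer, then a nonzero element \<open>[s, x, y] \<in> T\<close>, which exists by absorption of
  \<open>s\<close>, would centralize \<open>I\<close>.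
\<close>

context lie_triple_system
begin

section \<open>Trilinearity and the symmetries of the bracket\<close>

lemma br_add_1: "br (x + x') y z = br x y z + br x' y z"
  using linear_br_1 [of y z] by (simp add: Vector_Spaces.linear_iff)

lemma br_add_2: "br x (y + y') z = br x y z + br x y' z"
  using linear_br_2 [of x z] by (simp add: Vector_Spaces.linear_iff)

lemma br_scale_1: "br (scale c x) y z = scale c (br x y z)"
  using linear_br_1 [of y z] by (simp add: Vector_Spaces.linear_iff)

lemma br_scale_2: "br x (scale c y) z = scale c (br x y z)"
  using linear_br_2 [of x z] by (simp add: Vector_Spaces.linear_iff)

lemma br_scale_3: "br x y (scale c z) = scale c (br x y z)"
  using linear_br_3 [of x y] by (simp add: Vector_Spaces.linear_iff)

lemma br_zero [simp]: "br 0 y z = 0" "br x 0 z = 0" "br x y 0 = 0"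
  using br_scale_1 [of 0 0 y z] br_scale_2 [of x 0 0 z] br_scale_3 [of x y 0 0] by simp_all

text \<open>Polarization of \<open>br_self\<close>, which needs no division by 2 and so works in
  every characteristic.\<close>

lemma br_swap: "br y x z = - br x y z"
proof -
  have "br (x + y) (x + y) z = br x (x + y) z + br y (x + y) z"
    by (rule br_add_1)
  then have "br y x z + br x y z = 0"
    unfolding br_self by (simp add: br_add_2 br_self add.commute)
  then show ?thesis
    by (simp add: eq_neg_iff_add_eq_0)
qed

lemma br_eq_diff: "br x y z = br x z y - br y z x"
  using br_cyclic [of x y z] br_swap [of z x y] by (simp add: algebra_simps add_eq_0_iff)

section \<open>Elementwise forms of the conditions on brackets of subspaces\<close>

lemma Br_subset_iff:
  assumes "subspace U"
  shows "Br A B C \<subseteq> U \<longleftrightarrow> (\<forall>a\<in>A. \<forall>b\<in>B. \<forall>c\<in>C. br a b c \<in> U)" (is "?L \<longleftrightarrow> ?R")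
proof
  assume ?L
  then show ?R unfolding Br_def by (blast intro: span_base)
next
  assume ?R
  then show ?L unfolding Br_def by (intro span_minimal assms) blast
qed

lemma Br_eq_zero_iff: "Br A B C = {0} \<longleftrightarrow> (\<forall>a\<in>A. \<forall>b\<in>B. \<forall>c\<in>C. br a b c = 0)"
proof -
  have "0 \<in> Br A B C" by (simp add: Br_def span_zero)
  then have "Br A B C = {0} \<longleftrightarrow> Br A B C \<subseteq> {0}" by blast
  then show ?thesis using Br_subset_iff [OF subspace_single_0] by simp
qed

lemma Br_plus_subset_iff:
  assumes "subspace U"
  shows "Br A B C + Br A' B' C' \<subseteq> U \<longleftrightarrow> Br A B C \<subseteq> U \<and> Br A' B' C' \<subseteq> U"
proof -
  have "0 \<in> Br A B C" "0 \<in> Br A' B' C'" by (simp_all add: Br_def span_zero)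
  then have "Br A B C \<subseteq> Br A B C + Br A' B' C'" "Br A' B' C' \<subseteq> Br A B C + Br A' B' C'"
    by (metis add.right_neutral set_plus_intro subsetI, metis add.left_neutral set_plus_intro subsetI)
  moreover have "Br A B C + Br A' B' C' \<subseteq> U" if "Br A B C \<subseteq> U" "Br A' B' C' \<subseteq> U"
    using that assms by (auto elim!: set_plus_elim intro: subspace_add)
  ultimately show ?thesis by blast
qed

lemma Br_plus_eq_zero_iff:
  "Br A B C + Br A' B' C' = {0} \<longleftrightarrow> Br A B C = {0} \<and> Br A' B' C' = {0}"
proof -
  have "0 \<in> Br A B C" "0 \<in> Br A' B' C'" by (simp_all add: Br_def span_zero)
  moreover from this have "0 \<in> Br A B C + Br A' B' C'"
    by (metis add.right_neutral set_plus_intro)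
  ultimately show ?thesis
    using Br_plus_subset_iff [OF subspace_single_0, of A B C A' B' C'] by blast
qed

lemma subsystem_iff:
  "subsystem T \<longleftrightarrow> subspace T \<and> (\<forall>x\<in>T. \<forall>y\<in>T. \<forall>z\<in>T. br x y z \<in> T)"
  by (simp add: subsystem_def Br_subset_iff cong: conj_cong)

lemma ideal_of_iff:
  "ideal_of T I \<longleftrightarrow> subspace I \<and> I \<subseteq> T \<and> (\<forall>x\<in>I. \<forall>y\<in>T. \<forall>z\<in>T. br x y z \<in> I)"
  by (simp add: ideal_of_def Br_subset_iff cong: conj_cong)

lemma mem_centralizer_iff:
  "c \<in> centralizer T I \<longleftrightarrow> c \<in> T \<and> (\<forall>x\<in>I. \<forall>t\<in>T. br c x t = 0 \<and> br t x c = 0)"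
  unfolding centralizer_def Br_eq_zero_iff by auto

lemma mem_colon_iff:
  assumes "subspace T"
  shows "x \<in> colon T s \<longleftrightarrow>
    x \<in> T \<and> (\<forall>t\<in>T. \<forall>m\<in>orbit_span T s. br x t m \<in> T \<and> br x m t \<in> T)"
  unfolding colon_def mem_Collect_eq Br_plus_subset_iff [OF assms] Br_subset_iff [OF assms] by blast

section \<open>The orbit span as the smallest \<open>T\<close>-stable subspace through
  \<open>s\<close>\<close>

lemma mem_orbit_span: "s \<in> orbit_span T s"
  by (simp add: orbit_span_def span_base)

lemma subspace_orbit_span: "subspace (orbit_span T s)"
  by (simp add: orbit_span_def)

lemma orbit_span_br:
  assumes "m \<in> orbit_span T s" "x \<in> T" "y \<in> T"
  shows "br m x y \<in> orbit_span T s"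
proof -
  let ?G = "insert s {foldr (\<lambda>(x, y). R x y) ps s | ps. set ps \<subseteq> T \<times> T}"
  \<comment> \<open>The preimage of the span under the linear map \<open>R x y\<close>; on a
    generator this map only prepends \<open>(x, y)\<close> to the word.\<close>
  let ?V = "{m. br m x y \<in> span ?G}"
  have "?G \<subseteq> ?V"
  proof
    fix g assume "g \<in> ?G"
    \<comment> \<open>The element \<open>s\<close> itself is the empty word.\<close>
    then obtain ps where ps: "set ps \<subseteq> T \<times> T" "g = foldr (\<lambda>(x, y). R x y) ps s"
      by (auto intro: that [of "[]"])
    then have "br g x y = foldr (\<lambda>(x, y). R x y) ((x, y) # ps) s" "set ((x, y) # ps) \<subseteq> T \<times> T"
      using assms by (simp_all add: R_def)
    then have "br g x y \<in> ?G" by blast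
    then show "g \<in> ?V" by (simp only: mem_Collect_eq span_base)
  qed
  moreover have "subspace ?V"
    by (rule subspaceI) (simp_all add: br_add_1 br_scale_1 span_zero span_add span_scale)
  ultimately have "span ?G \<subseteq> ?V" by (rule span_minimal)
  then show ?thesis using assms(1) unfolding orbit_span_def by blast
qed

lemma orbit_span_subset:
  assumes "subspace V" "s \<in> V" "\<And>m x y. m \<in> V \<Longrightarrow> x \<in> T \<Longrightarrow> y \<in> T \<Longrightarrow> br m x y \<in> V"
  shows "orbit_span T s \<subseteq> V"
proof -
  have "foldr (\<lambda>(x, y). R x y) ps s \<in> V" if "set ps \<subseteq> T \<times> T" for ps
    using that by (induction ps) (auto simp: R_def assms)
  then show ?thesis unfolding orbit_span_def
    by (intro span_minimal assms) (use assms(2) in auto)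
qed

lemma subspace_br_swap:
  assumes "subspace U" "br x y z \<in> U"
  shows "br y x z \<in> U"
  using assms subspace_neg br_swap by metis

lemma subspace_br_cyclic:
  assumes "subspace U" "br x z y \<in> U" "br y z x \<in> U"
  shows "br x y z \<in> U"
  using assms subspace_diff br_eq_diff by metis

text \<open>By skew symmetry and the cyclic identity, all six arrangements of three arguments are
  combinations of the two with \<open>x\<close> in front.\<close>

lemma subspace_br_perms:
  assumes "subspace U" "br x y z \<in> U" "br x z y \<in> U"
  shows "br y x z \<in> U" "br z x y \<in> U" "br y z x \<in> U" "br z y x \<in> U"
proof -
  show 1: "br y x z \<in> U" "br z x y \<in> U"
    using assms subspace_br_swap by blast+
  show 2: "br y z x \<in> U"
    using subspace_br_cyclic [OF assms(1) 1(1)] assms subspace_br_swap by blast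
  show "br z y x \<in> U" using 2 assms(1) subspace_br_swap by blast
qed

text \<open>The derivation identity solved for the term whose inner bracket stands in the first
  slot.\<close>

lemma subspace_br_derivation:
  assumes "subspace U" "br u v (br x y z) \<in> U" "br x (br u v y) z \<in> U" "br x y (br u v z) \<in> U"
  shows "br (br u v x) y z \<in> U"
proof -
  have "br (br u v x) y z = br u v (br x y z) - br x (br u v y) z - br x y (br u v z)"
    by (simp add: br_derivation [of u v x y z])
  then show ?thesis using assms by (simp add: subspace_diff)
qed

section \<open>Ideals, stability under \<open>R a b\<close>, and the ideal
  \<open>colon T s\<close>\<close>

lemma ideal_of_br:
  assumes "ideal_of T I" "x \<in> I" "y \<in> T" "z \<in> T"
  shows "br x y z \<in> I" "br y x z \<in> I" "br y z x \<in> I"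
proof -
  have I: "subspace I" "\<And>y z. y \<in> T \<Longrightarrow> z \<in> T \<Longrightarrow> br x y z \<in> I"
    using assms by (auto simp: ideal_of_iff)
  show "br x y z \<in> I" using I assms by blast
  show "br y x z \<in> I" "br y z x \<in> I"
    using subspace_br_perms [OF I(1) I(2) I(2), of y z] assms by blast+
qed

text \<open>Here \<open>m\<close> ranges over all of \<open>S\<close>. The derivation identity
  leaves terms of two kinds: an inner bracket in \<open>U\<close>, kept there by the ideal property
  of \<open>U\<close>, or \<open>m\<close> bracketed with an element of \<open>I\<close> and one of
  \<open>T\<close>.\<close>

lemma transporter_br:
  assumes I: "ideal_of T I" and U: "ideal_of T U"
    and T: "a \<in> T" "b \<in> T" "x \<in> I" "t \<in> T"
    and m1: "\<And>x t. x \<in> I \<Longrightarrow> t \<in> T \<Longrightarrow> br m x t \<in> U"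
    and m2: "\<And>x t. x \<in> I \<Longrightarrow> t \<in> T \<Longrightarrow> br m t x \<in> U"
  shows "br (br m a b) x t \<in> U" "br (br m a b) t x \<in> U"
proof -
  have sU: "subspace U" using U by (simp add: ideal_of_iff)
  have m3: "br x t m \<in> U" if "x \<in> I" "t \<in> T" for x t
    using subspace_br_perms(3) [OF sU m1 m2] that by blast
  \<comment> \<open>The arrangement with the new element last serves twice: for one term of the
    first claim, and with the cyclic identity for the second.\<close>
  have key: "br x p (br m a q) \<in> U" if "p \<in> T" "q \<in> T" for p q
    unfolding br_derivation [of x p m a q]
  proof (intro subspace_add sU)
    show "br (br x p m) a q \<in> U" by (intro ideal_of_br(1) [OF U] m3 T that)
    show "br m (br x p a) q \<in> U" by (intro m1 ideal_of_br(1) [OF I] T that)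
    show "br m a (br x p q) \<in> U" by (intro m2 ideal_of_br(1) [OF I] T that)
  qed
  show 1: "br (br m a b) x t \<in> U"
  proof (rule subspace_br_derivation [OF sU])
    show "br m a (br b x t) \<in> U" by (intro m2 ideal_of_br(2) [OF I] T)
    show "br b (br m a x) t \<in> U" by (intro ideal_of_br(2) [OF U] m2 T)
    show "br b x (br m a t) \<in> U"
      using subspace_br_swap [OF sU key] T by blast
  qed
  show "br (br m a b) t x \<in> U"
    using subspace_br_cyclic [OF sU 1 subspace_br_swap [OF sU key]] T by blast
qed

text \<open>Permits \<open>U = T\<close> in \<open>transporter_br\<close>.\<close>

lemma subsystem_ideal_of_self: "subsystem T \<Longrightarrow> ideal_of T T"
  by (simp add: ideal_of_iff subsystem_iff)

lemma ideal_of_subset_colon: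
  assumes sub: "subsystem T" and I: "ideal_of T I"
    and s: "\<And>x t. x \<in> I \<Longrightarrow> t \<in> T \<Longrightarrow> br s x t \<in> T \<and> br s t x \<in> T"
  shows "I \<subseteq> colon T s"
proof
  fix x assume x: "x \<in> I"
  have sT: "subspace T" using sub by (simp add: subsystem_iff)
  let ?V = "{m. \<forall>x\<in>I. \<forall>t\<in>T. br m x t \<in> T \<and> br m t x \<in> T}"
  have "subspace ?V"
    using sT by (intro subspaceI)
      (simp_all add: br_add_1 br_scale_1 subspace_0 subspace_add subspace_scale)
  moreover have "br m a b \<in> ?V" if "m \<in> ?V" "a \<in> T" "b \<in> T" for m a b
    using that transporter_br [OF I subsystem_ideal_of_self [OF sub], of a b _ _ m] by blast
  ultimately have "orbit_span T s \<subseteq> ?V"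
    using s by (intro orbit_span_subset) auto
  then have "br m x t \<in> T \<and> br m t x \<in> T" if "m \<in> orbit_span T s" "t \<in> T" for m t
    using x that by blast
  then show "x \<in> colon T s"
    unfolding mem_colon_iff [OF sT]
    using subspace_br_perms [OF sT, of _ x] x I ideal_of_iff by blast
qed

text \<open>The derivation identity moves outer brackets onto \<open>x\<close> or onto elements of
  the orbit span, and the latter is stable under brackets with \<open>T\<close>.\<close>

lemma ideal_of_colon:
  assumes sub: "subsystem T"
  shows "ideal_of T (colon T s)"
proof -
  have sT: "subspace T" and TTT: "\<And>x y z. x \<in> T \<Longrightarrow> y \<in> T \<Longrightarrow> z \<in> T \<Longrightarrow> br x y z \<in> T"
    using sub by (auto simp: subsystem_iff)
  let ?M = "orbit_span T s"
  have M1: "br m a b \<in> ?M" "br a m b \<in> ?M" if "m \<in> ?M" "a \<in> T" "b \<in> T" for m a b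
    using that orbit_span_br subspace_br_swap [OF subspace_orbit_span] by blast+
  have c1: "x \<in> T" if "x \<in> colon T s" for x
    using that mem_colon_iff [OF sT] by blast
  have c2: "br x t m \<in> T" "br x m t \<in> T" if "x \<in> colon T s" "t \<in> T" "m \<in> ?M" for x t m
    using that mem_colon_iff [OF sT] by blast+
  note c3 = subspace_br_perms [OF sT c2]
  have "br x a b \<in> colon T s" if x: "x \<in> colon T s" and ab: "a \<in> T" "b \<in> T" for x a b
  proof -
    \<comment> \<open>The last argument \<open>b\<close> is quantified afresh, since the next step
      uses this fact with \<open>t\<close> in its place.\<close>
    have 1: "br t m (br x a b) \<in> T" if "t \<in> T" "m \<in> ?M" "b \<in> T" for t m b
      unfolding br_derivation [of t m x a b]
    proof (intro subspace_add sT)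
      show "br (br t m x) a b \<in> T" by (intro TTT c3 x ab that)
      show "br x (br t m a) b \<in> T" by (intro c2 M1 x ab that)
      show "br x a (br t m b) \<in> T" by (intro c2 M1 x ab that)
    qed
    have 2: "br (br x a b) m t \<in> T" if "t \<in> T" "m \<in> ?M" for t m
    proof (rule subspace_br_derivation [OF sT])
      show "br x a (br b m t) \<in> T" by (intro c2 M1 x ab that)
      show "br b (br x a m) t \<in> T" by (intro TTT c2 x ab that)
      show "br b m (br x a t) \<in> T" by (intro 1 ab that)
    qed
    have "br (br x a b) t m \<in> T" if "t \<in> T" "m \<in> ?M" for t m
      using subspace_br_cyclic [OF sT 2 1] that ab by blast
    then show ?thesis
      unfolding mem_colon_iff [OF sT] using 2 x ab c1 TTT by blast
  qed
  moreover have "subspace (colon T s)"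
    using sT by (intro subspaceI) (simp_all add: mem_colon_iff [OF sT] br_add_1 br_scale_1
        subspace_0 subspace_add subspace_scale)
  ultimately show ?thesis using c1 unfolding ideal_of_iff by blast
qed

section \<open>The two implications\<close>

lemma ideally_absorbed_iff:
  assumes "subspace T"
  shows "ideally_absorbed T \<longleftrightarrow>
    (\<forall>s. s \<noteq> 0 \<longrightarrow> (\<exists>I. ideal_of T I \<and> centralizer T I = {0} \<and>
       (\<exists>x\<in>I. \<exists>t\<in>T. br s x t \<noteq> 0 \<or> br s t x \<noteq> 0) \<and>
       (\<forall>x\<in>I. \<forall>t\<in>T. br s x t \<in> T \<and> br s t x \<in> T)))"
proof -
  have 1: "Br {s} I T + Br {s} T I \<noteq> {0} \<longleftrightarrow> (\<exists>x\<in>I. \<exists>t\<in>T. br s x t \<noteq> 0 \<or> br s t x \<noteq> 0)" for s I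
    unfolding Br_plus_eq_zero_iff Br_eq_zero_iff by blast
  have 2: "Br {s} I T + Br {s} T I \<subseteq> T \<longleftrightarrow> (\<forall>x\<in>I. \<forall>t\<in>T. br s x t \<in> T \<and> br s t x \<in> T)" for s I
    unfolding Br_plus_subset_iff [OF assms] Br_subset_iff [OF assms] by blast
  show ?thesis unfolding ideally_absorbed_def 1 2 ..
qed

lemma system_of_quotients_imp_ideally_absorbed:
  assumes sub: "subsystem T" and Q: "system_of_quotients T"
  shows "ideally_absorbed T"
proof -
  have sT: "subspace T" using sub by (simp add: subsystem_iff)
  show ?thesis unfolding ideally_absorbed_iff [OF sT]
  proof (intro allI impI exI conjI)
    fix s :: 'v assume s: "s \<noteq> 0"
    show "ideal_of T (colon T s)" by (rule ideal_of_colon [OF sub])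
    show "centralizer T (colon T s) = {0}"
    proof (intro equalityI subsetI)
      fix c assume "c \<in> centralizer T (colon T s)"
      then have c: "br c x t = 0" "br t x c = 0" if "x \<in> colon T s" "t \<in> T" for x t
        using that mem_centralizer_iff by blast+
      then have "br c t x = 0" if "x \<in> colon T s" "t \<in> T" for x t
        using that br_eq_diff [of c t x] by simp
      \<comment> \<open>If \<open>c\<close> were nonzero, the quotient condition for the pair
        \<open>c\<close>, \<open>s\<close> would give a nonzero bracket of \<open>c\<close> with an
        element of \<open>colon T s\<close> and one of \<open>T\<close>.\<close>
      with c(1) Q show "c \<in> {0}"
        unfolding system_of_quotients_def by blast
    qed (use sT in \<open>auto simp: mem_centralizer_iff subspace_0\<close>)
    \<comment> \<open>The quotient condition with both elements equal to \<open>s\<close>.\<close>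
    show "\<exists>x\<in>colon T s. \<exists>t\<in>T. br s x t \<noteq> 0 \<or> br s t x \<noteq> 0"
      using Q s unfolding system_of_quotients_def by blast
    have "br x t s \<in> T" "br x s t \<in> T" if "x \<in> colon T s" "t \<in> T" for x t
      using that mem_colon_iff [OF sT] mem_orbit_span by blast+
    then show "\<forall>x\<in>colon T s. \<forall>t\<in>T. br s x t \<in> T \<and> br s t x \<in> T"
      using subspace_br_perms(2,4) [OF sT] by blast
  qed
qed

text \<open>Needed because the ideal chosen to absorb \<open>s'\<close> is unrelated to
  \<open>s\<close>, yet must still act nontrivially on \<open>s\<close>.\<close>

lemma ideally_absorbed_annihilator_zero:
  assumes sub: "subsystem T" and A: "ideally_absorbed T"
    and I: "ideal_of T I" "centralizer T I = {0}"
    and s: "\<And>x t. x \<in> I \<Longrightarrow> t \<in> T \<Longrightarrow> br s x t = 0 \<and> br s t x = 0"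
  shows "s = 0"
proof (rule ccontr)
  assume "s \<noteq> 0"
  have sT: "subspace T" using sub by (simp add: subsystem_iff)
  \<comment> \<open>One of \<open>a\<close>, \<open>b\<close> comes from an ideal absorbing
    \<open>s\<close>, which may differ from \<open>I\<close>.\<close>
  obtain a b where ab: "a \<in> T" "b \<in> T" "br s a b \<in> T" "br s a b \<noteq> 0"
    using A \<open>s \<noteq> 0\<close> unfolding ideally_absorbed_iff [OF sT] ideal_of_iff by blast
  have "ideal_of T {0}" using sT by (auto simp: ideal_of_iff subspace_0)
  then have 1: "br (br s a b) x t = 0" "br (br s a b) t x = 0" if "x \<in> I" "t \<in> T" for x t
    using that transporter_br [OF I(1) _ ab(1,2), of "{0}" x t s] s by auto
  moreover have "br t x (br s a b) = 0" if "x \<in> I" "t \<in> T" for x t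
    using 1 that br_eq_diff [of t x "br s a b"] br_swap [of "br s a b"] by simp
  ultimately have "br s a b \<in> centralizer T I"
    unfolding mem_centralizer_iff using ab by blast
  then show False using I ab by simp
qed

lemma ideally_absorbed_imp_system_of_quotients:
  assumes sub: "subsystem T" and A: "ideally_absorbed T"
  shows "system_of_quotients T"
  unfolding system_of_quotients_def
proof (intro allI impI)
  fix s s' :: 'v assume s: "s \<noteq> 0"
  have sT: "subspace T" using sub by (simp add: subsystem_iff)
  obtain I where I: "ideal_of T I" "centralizer T I = {0}"
    and s': "\<And>x t. x \<in> I \<Longrightarrow> t \<in> T \<Longrightarrow> br s' x t \<in> T \<and> br s' t x \<in> T"
  \<comment> \<open>Absorption says nothing about the zero element, so the ideal belonging to
    \<open>s\<close> is taken there.\<close>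
  proof (cases "s' = 0")
    case True
    obtain I where "ideal_of T I" "centralizer T I = {0}"
      using A s unfolding ideally_absorbed_iff [OF sT] by blast
    then show thesis using that True subspace_0 [OF sT] by simp
  next
    case False
    then show thesis using A that unfolding ideally_absorbed_iff [OF sT] by blast
  qed
  have "I \<subseteq> colon T s'" "I \<subseteq> T"
    using ideal_of_subset_colon [OF sub I(1) s'] I(1) ideal_of_iff by blast+
  \<comment> \<open>The element \<open>x\<close> of \<open>I\<close> may occupy either slot,
    matching the disjunction in the quotient condition.\<close>
  moreover obtain x t where "x \<in> I" "t \<in> T" "br s x t \<noteq> 0 \<or> br s t x \<noteq> 0"
    using ideally_absorbed_annihilator_zero [OF sub A I, of s] s by blast
  ultimately show "\<exists>x\<in>T. \<exists>y\<in>T. br s x y \<noteq> 0 \<and> (x \<in> colon T s' \<or> y \<in> colon T s')"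
    by blast
qed

end

theorem theorem3p10:
  fixes scale :: "'f::field \<Rightarrow> 'v::ab_group_add \<Rightarrow> 'v"
    and br :: "'v \<Rightarrow> 'v \<Rightarrow> 'v \<Rightarrow> 'v"
    and T :: "'v set"
  assumes "lie_triple_system scale br"
    and "lie_triple_system.subsystem scale br T"
  shows "lie_triple_system.system_of_quotients scale br T \<longleftrightarrow>
         lie_triple_system.ideally_absorbed scale br T"
  using lie_triple_system.system_of_quotients_imp_ideally_absorbed [OF assms]
    lie_triple_system.ideally_absorbed_imp_system_of_quotients [OF assms] by blast

end
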